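(* Let $m,n\in\mathbb{N}$ and let $\mu$ be a probability measure on $M_{m,n}$ that is absolutely continuous with respect to Lebesgue measure on $M_{m,n}$. Let $\Psi:\mathbb{Z}^n\to\mathbb{R}_+$ be any function such that $\Sigma_\Psi:=\sum_{\mathbf{a}\in\mathbb{Z}^n\setminus\{\mathbf{0}\}}\Psi(\mathbf{a})^m<\infty$. Then for any $\delta\in(0,1)$ there is a constant $\kappa>0$ depending only on $\mu$, $\Psi$ and $\delta$ such that $$\mu\left(\mathcal{B}_{m,n}(\Psi,\kappa)\right)\ge 1-\delta,$$ where $\mathcal{B}_{m,n}(\Psi,\kappa):=\{\mathbf{X}\in M_{m,n}:\ \|\mathbf{X}\mathbf{a}\|>\kappa\Psi(\mathbf{a})\ \text{for all }\mathbf{a}\in\mathbb{Z}^n\setminus\{\mathbf{0}\}\}$.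
   Context: $M_{m,n}$ denotes the set of $m\times n$ real matrices, identified with $\mathbb{R}^{mn}$. $\mathbb{R}_+$ is the set of non-negative reals. For $x\in\mathbb{R}$, $\|x\|=\min\{|x-k|:k\in\mathbb{Z}\}$. For $\mathbf{X}=(x_{i,j})\in M_{m,n}$ and $\mathbf{a}=(a_1,\dots,a_n)\in\mathbb{Z}^n$, $\|\mathbf{X}\mathbf{a}\|:=\max_{1\le i\le m}\|x_{i,1}a_1+\dots+x_{i,n}a_n\|$. *)

theory Defs
  imports "HOL-Probability.Probability"
begin

text \<open>Real \<open>m \<times> n\<close> matrices are elements of \<^typ>\<open>real^'n^'m\<close> with \<open>m = CARD('m)\<close> rows and
  \<open>n = CARD('n)\<close> columns. This is a Euclidean space whose \<^const>\<open>lborel\<close> is Lebesgue measure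
  on \<open>\<real>\<^sup>m\<^sup>n\<close>.\<close>

definition dist_int :: "real \<Rightarrow> real"
  where "dist_int x = (INF k::int. \<bar>x - of_int k\<bar>)"

text \<open>The infimum is a minimum:\<close>

lemma dist_int_attained: "\<exists>k::int. dist_int x = \<bar>x - of_int k\<bar>"
proof
  have "\<bar>x - of_int (round x)\<bar> \<le> \<bar>x - of_int k\<bar>" for k :: int
    using round_diff_minimal[of x k] by simp
  then show "dist_int x = \<bar>x - of_int (round x)\<bar>"
    unfolding dist_int_def by (intro cInf_eq_minimum) auto
qed

lemma dist_int_le: "dist_int x \<le> \<bar>x - of_int k\<bar>"
  unfolding dist_int_def by (intro cINF_lower bdd_belowI2[of _ 0]) auto

definition dist_int_mult :: "real^'n^'m \<Rightarrow> int^'n \<Rightarrow> real"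
  where "dist_int_mult X a = (MAX i\<in>UNIV. dist_int (\<Sum>j\<in>UNIV. X $ i $ j * of_int (a $ j)))"

definition badly_approx :: "(int^'n \<Rightarrow> real) \<Rightarrow> real \<Rightarrow> (real^'n^'m) set"
  where "badly_approx \<Psi> \<kappa> = {X. \<forall>a. a \<noteq> 0 \<longrightarrow> dist_int_mult X a > \<kappa> * \<Psi> a}"

end

theory Submission
  imports Defs
begin

text \<open>For \<open>a \<noteq> 0\<close>, the matrices \<open>X\<close> in a fixed cube with \<open>\<parallel>X a\<parallel> \<le> r\<close> have Lebesgue measure at
  most \<open>C r\<^sup>m\<close>, where \<open>C\<close> does not depend on \<open>a\<close>: the condition is the same for each of the \<open>m\<close> rows,
  and in a row it is a one-dimensional condition on an entry whose coefficient in \<open>a\<close> is non-zero.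
  With \<open>r = \<kappa> \<Psi>(a)\<close>, summing over \<open>a\<close> shows that the complement of the set of badly approximable
  matrices has measure \<open>O(\<kappa>\<^sup>m)\<close> in each cube. Hence Lebesgue-almost every, and so \<open>\<mu>\<close>-almost every,
  matrix is badly approximable for some \<open>\<kappa>\<close>, and continuity of \<open>\<mu>\<close> from above gives the claim. The
  vectors with \<open>\<Psi>(a) = 0\<close> need no special care, since the bound \<open>C r\<^sup>m\<close> is valid for \<open>r = 0\<close>.\<close>

section \<open>Distance to the nearest integer\<close>

lemma dist_int_eq_round: "dist_int x = \<bar>x - of_int (round x)\<bar>"
proof (rule antisym)
  show "dist_int x \<le> \<bar>x - of_int (round x)\<bar>" by (rule dist_int_le)
  obtain k where "dist_int x = \<bar>x - of_int k\<bar>" using dist_int_attained by blast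
  then show "\<bar>x - of_int (round x)\<bar> \<le> dist_int x" using round_diff_minimal[of x k] by simp
qed

lemma dist_int_le_half: "dist_int x \<le> 1/2"
  using of_int_round_abs_le[of x] by (simp add: dist_int_eq_round abs_minus_commute)

lemma borel_measurable_dist_int [measurable]: "dist_int \<in> borel_measurable borel"
  unfolding dist_int_eq_round[abs_def] round_def by measurable

section \<open>Lebesgue measure on vectors as a product measure\<close>

lemma borel_measurable_vec_nth [measurable]:
  "(\<lambda>x. x $ i) \<in> borel_measurable (borel :: ('a::euclidean_space^'k) measure)"
  by (intro borel_measurable_continuous_onI continuous_intros)

lemma borel_measurable_vec_lambda [measurable]:
  "(\<lambda>f. \<chi> i. f i) \<in> borel_measurable (\<Pi>\<^sub>M i\<in>(UNIV :: 'k::finite set). (lborel :: 'a::euclidean_space measure))"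
  by (rule borel_measurable_euclidean_space[THEN iffD2]) (auto simp: Basis_vec_def inner_axis)

text \<open>Lebesgue measure is determined by its values on boxes, and a box of vectors is a product
  of boxes in the components. The component type is left general for two uses: \<open>real\<close>
  splits a row into entries, \<open>real^'n\<close> splits a matrix into rows.\<close>

lemma lborel_vec_eq_distr_PiM:
  "lborel = distr (\<Pi>\<^sub>M i\<in>(UNIV :: 'k::finite set). (lborel :: 'a::euclidean_space measure)) borel (\<lambda>f. \<chi> i. f i)"
proof (rule lborel_eqI)
  interpret product_sigma_finite "\<lambda>i::'k. lborel :: 'a measure" by standard
  fix l u :: "'a^'k" assume le: "\<And>b. b \<in> Basis \<Longrightarrow> l \<bullet> b \<le> u \<bullet> b"
  have le': "l $ i \<bullet> b \<le> u $ i \<bullet> b" if "b \<in> Basis" for i b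
    using le[of "axis i b"] that by (auto simp: Basis_vec_def inner_axis)
  have pre: "(\<lambda>f. \<chi> i. f i) -` box l u \<inter> space (\<Pi>\<^sub>M i\<in>(UNIV :: 'k set). (lborel :: 'a measure))
      = (\<Pi>\<^sub>E i\<in>UNIV. box (l $ i) (u $ i))"
    by (auto simp: mem_box Basis_vec_def inner_axis space_PiM PiE_iff)
  have B: "(Basis :: ('a^'k) set) = (\<lambda>(i, b). axis i b) ` (UNIV \<times> Basis)"
    by (auto simp: Basis_vec_def image_iff)
  have inj: "inj_on (\<lambda>(i, b). axis i b :: 'a^'k) (UNIV \<times> Basis)"
    by (auto simp: inj_on_def axis_eq_axis)
  have "emeasure (distr (\<Pi>\<^sub>M i\<in>(UNIV :: 'k set). (lborel :: 'a measure)) borel (\<lambda>f. \<chi> i. f i)) (box l u)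
      = (\<Prod>i\<in>UNIV. emeasure lborel (box (l $ i) (u $ i)))"
    by (simp add: emeasure_distr pre emeasure_PiM)
  also have "\<dots> = (\<Prod>i\<in>UNIV. ennreal (\<Prod>b\<in>Basis. (u $ i - l $ i) \<bullet> b))"
    using le' by (intro prod.cong refl emeasure_lborel_box) auto
  also have "\<dots> = ennreal (\<Prod>i\<in>UNIV. \<Prod>b\<in>Basis. (u $ i - l $ i) \<bullet> b)"
    using le' by (intro prod_ennreal prod_nonneg) (auto simp: inner_diff_left)
  also have "(\<Prod>i\<in>UNIV. \<Prod>b\<in>Basis. (u $ i - l $ i) \<bullet> b) = (\<Prod>b\<in>Basis. (u - l) \<bullet> b)"
    unfolding B by (subst prod.reindex[OF inj]) (simp add: prod.cartesian_product inner_axis split_beta)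
  finally show "emeasure (distr (\<Pi>\<^sub>M i\<in>(UNIV :: 'k set). (lborel :: 'a measure)) borel (\<lambda>f. \<chi> i. f i)) (box l u)
      = (\<Prod>b\<in>Basis. (u - l) \<bullet> b)" .
qed simp

section \<open>Measure estimates for a single integer vector\<close>

lemma emeasure_dist_int_affine_le:
  fixes a :: int and N r b :: real
  assumes a: "a \<noteq> 0" and N: "0 \<le> N" and r: "0 \<le> r"
  shows "emeasure lborel {x. \<bar>x\<bar> \<le> N \<and> dist_int (x * of_int a + b) \<le> r} \<le> ennreal ((4 * N + 4) * r)"
proof -
  \<comment> \<open>At most \<open>2 N \<bar>a\<bar> + 2\<close> integers can be nearest to some \<open>x a + b\<close>, uniformly in \<open>r\<close>, and each
    contributes an interval of length \<open>2 r / \<bar>a\<bar>\<close>.\<close>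
  define c where "c = \<bar>real_of_int a\<bar>"
  have c1: "1 \<le> c" unfolding c_def using a by linarith
  define K where "K = {\<lceil>b - N * c - 1/2\<rceil>..\<lfloor>b + N * c + 1/2\<rfloor>}"
  define I where "I k = cbox ((of_int k - b) / of_int a - r / c) ((of_int k - b) / of_int a + r / c)" for k :: int
  have sub: "{x. \<bar>x\<bar> \<le> N \<and> dist_int (x * of_int a + b) \<le> r} \<subseteq> (\<Union>k\<in>K. I k)"
  proof safe
    fix x :: real assume x: "\<bar>x\<bar> \<le> N" "dist_int (x * of_int a + b) \<le> r"
    define k where "k = round (x * of_int a + b)"
    \<comment> \<open>The first bound puts \<open>x\<close> into \<open>I k\<close>, the second puts
      \<open>k\<close> into \<open>K\<close>. A window of half-width 1/2 instead of \<open>r\<close>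
      keeps the final estimate linear in \<open>r\<close>, for large \<open>r\<close> too.\<close>
    have k: "\<bar>x * of_int a + b - of_int k\<bar> \<le> r" "\<bar>x * of_int a + b - of_int k\<bar> \<le> 1/2"
      using x(2) dist_int_le_half[of "x * of_int a + b"] by (simp_all add: dist_int_eq_round k_def)
    have "\<bar>x * of_int a\<bar> \<le> N * c"
      using x(1) by (simp add: abs_mult c_def mult_right_mono)
    then have "k \<in> K" using k(2) unfolding K_def atLeastAtMost_iff ceiling_le_iff le_floor_iff by linarith
    moreover have "x - (of_int k - b) / of_int a = (x * of_int a + b - of_int k) / of_int a"
      using a by (simp add: field_simps)
    then have "\<bar>x - (of_int k - b) / of_int a\<bar> \<le> r / c"
      using k(1) c1 by (simp add: c_def divide_right_mono)
    then have "x \<in> I k" unfolding I_def by (auto simp: abs_le_iff)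
    ultimately show "x \<in> (\<Union>k\<in>K. I k)" by blast
  qed
  have cardK: "real (card K) \<le> (2 * N + 2) * c"
  proof -
    have "real (card K) \<le> max 0 (2 * N * c + 2)" unfolding K_def by simp linarith
    \<comment> \<open>As \<open>c\<close> is at least 1, it absorbs the additive 2. The factor
      \<open>c\<close> then cancels against the interval length \<open>2 * r / c\<close>, so the
      bound does not depend on \<open>a\<close>.\<close>
    also have "\<dots> \<le> (2 * N + 2) * c" using c1 N by (auto simp: algebra_simps)
    finally show ?thesis .
  qed
  have "emeasure lborel {x. \<bar>x\<bar> \<le> N \<and> dist_int (x * of_int a + b) \<le> r} \<le> emeasure lborel (\<Union>k\<in>K. I k)"
    by (intro emeasure_mono sub) (auto simp: I_def K_def)
  also have "\<dots> \<le> (\<Sum>k\<in>K. emeasure lborel (I k))"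
    by (intro emeasure_subadditive_finite) (auto simp: I_def K_def)
  also have "\<dots> = (\<Sum>k\<in>K. ennreal (2 * r / c))"
    using r c1 by (intro sum.cong refl) (simp add: I_def)
  also have "\<dots> = ennreal (real (card K) * (2 * r / c))"
    using r c1 by (simp add: ennreal_of_nat_eq_real_of_nat flip: ennreal_mult)
  also have "\<dots> \<le> ennreal (((2 * N + 2) * c) * (2 * r / c))"
    using r c1 cardK by (intro ennreal_leI mult_right_mono) auto
  also have "((2 * N + 2) * c) * (2 * r / c) = (4 * N + 4) * r"
    using c1 by (simp add: field_simps)
  finally show ?thesis .
qed

text \<open>Integrate first over an entry \<open>j0\<close> with \<open>a $ j0 \<noteq> 0\<close>.
  The other entries only contribute a shift \<open>b\<close>, in which the one-dimensional bound is
  uniform, and they range over a cube of volume \<open>(2 * N) ^ (CARD('n) - 1)\<close>.\<close>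

lemma emeasure_dist_int_row_le:
  fixes a :: "int^'n" and N r :: real
  assumes a: "a \<noteq> 0" and N: "0 \<le> N" and r: "0 \<le> r"
  shows "emeasure lborel {x :: real^'n. (\<forall>j. \<bar>x $ j\<bar> \<le> N) \<and> dist_int (\<Sum>j\<in>UNIV. x $ j * of_int (a $ j)) \<le> r}
    \<le> ennreal ((4 * N + 4) * r * (2 * N) ^ (CARD('n) - 1))" (is "emeasure lborel ?A \<le> _")
proof -
  interpret product_sigma_finite "\<lambda>i::'n. lborel :: real measure" by standard
  obtain j0 where j0: "a $ j0 \<noteq> 0" using a by (auto simp: vec_eq_iff)
  define J where "J = UNIV - {j0}"
  have J: "finite J" "j0 \<notin> J" "insert j0 J = UNIV" "card J = CARD('n) - 1"
    by (auto simp: J_def card_Diff_singleton)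
  have [measurable]: "?A \<in> sets borel" by measurable
  have "emeasure lborel ?A = emeasure (distr (\<Pi>\<^sub>M i\<in>(UNIV :: 'n set). lborel) borel (\<lambda>f. \<chi> i. f i)) ?A"
    by (subst lborel_vec_eq_distr_PiM) simp
  also have "\<dots> = (\<integral>\<^sup>+x. indicator ?A x \<partial>distr (\<Pi>\<^sub>M i\<in>(UNIV :: 'n set). lborel) borel (\<lambda>f. \<chi> i. f i))"
    by (rule nn_integral_indicator[symmetric]) simp
  also have "\<dots> = (\<integral>\<^sup>+f. indicator ?A (\<chi> i. f i) \<partial>(\<Pi>\<^sub>M i\<in>insert j0 J. lborel))"
    unfolding J(3) by (rule nn_integral_distr) simp_all
  also have "\<dots> = (\<integral>\<^sup>+f. (\<integral>\<^sup>+y. indicator ?A (\<chi> i. (f(j0 := y)) i) \<partial>lborel) \<partial>(\<Pi>\<^sub>M i\<in>J. lborel))"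
    by (rule product_nn_integral_insert[OF J(1,2)]) (simp add: J(3))
  also have "\<dots> \<le> (\<integral>\<^sup>+f. ennreal ((4 * N + 4) * r) * indicator (\<Pi>\<^sub>E j\<in>J. {-N..N}) f \<partial>(\<Pi>\<^sub>M i\<in>J. lborel))"
  proof (rule nn_integral_mono)
    fix f assume "f \<in> space (\<Pi>\<^sub>M i\<in>J. (lborel :: real measure))"
    then have f: "f \<in> extensional J" by (auto simp: space_PiM PiE_def)
    define b where "b = (\<Sum>j\<in>J. f j * of_int (a $ j))"
    have sum: "(\<Sum>j\<in>UNIV. (\<chi> i. (f(j0 := y)) i) $ j * of_int (a $ j)) = y * of_int (a $ j0) + b" for y
      unfolding J(3)[symmetric] b_def using J(1,2)
      by (auto intro!: sum.cong)
    have [measurable]: "{x. \<bar>x\<bar> \<le> N \<and> dist_int (x * of_int (a $ j0) + b) \<le> r} \<in> sets borel"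
      by measurable
    \<comment> \<open>The bounds on the remaining entries become a factor free of \<open>y\<close>.
      It leaves the inner integral and confines the outer one to a cube.\<close>
    have "(\<integral>\<^sup>+y. indicator ?A (\<chi> i. (f(j0 := y)) i) \<partial>lborel)
        \<le> (\<integral>\<^sup>+y. indicator {x. \<bar>x\<bar> \<le> N \<and> dist_int (x * of_int (a $ j0) + b) \<le> r} y
              * indicator (\<Pi>\<^sub>E j\<in>J. {-N..N}) f \<partial>lborel)"
    proof (rule nn_integral_mono)
      fix y :: real
      have "\<bar>y\<bar> \<le> N \<and> dist_int (y * of_int (a $ j0) + b) \<le> r \<and> f \<in> (\<Pi>\<^sub>E j\<in>J. {-N..N})"
        if "(\<chi> i. (f(j0 := y)) i) \<in> ?A"
      proof -
        from that have *: "\<bar>(f(j0 := y)) j\<bar> \<le> N" for j by auto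
        have "\<bar>f j\<bar> \<le> N" if "j \<in> J" for j
          using *[of j] that J(2) by (auto split: if_splits)
        then have "f \<in> (\<Pi>\<^sub>E j\<in>J. {-N..N})" using f by (auto simp: PiE_iff abs_le_iff minus_le_iff)
        moreover have "\<bar>y\<bar> \<le> N" using *[of j0] by simp
        ultimately show ?thesis using that unfolding mem_Collect_eq sum by blast
      qed
      then show "(indicator ?A (\<chi> i. (f(j0 := y)) i) :: ennreal)
        \<le> indicator {x. \<bar>x\<bar> \<le> N \<and> dist_int (x * of_int (a $ j0) + b) \<le> r} y * indicator (\<Pi>\<^sub>E j\<in>J. {-N..N}) f"
        by (auto simp: indicator_def)
    qed
    also have "\<dots> = emeasure lborel {x. \<bar>x\<bar> \<le> N \<and> dist_int (x * of_int (a $ j0) + b) \<le> r}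
        * indicator (\<Pi>\<^sub>E j\<in>J. {-N..N}) f"
      by (subst nn_integral_multc) simp_all
    also have "\<dots> \<le> ennreal ((4 * N + 4) * r) * indicator (\<Pi>\<^sub>E j\<in>J. {-N..N}) f"
      by (intro mult_right_mono emeasure_dist_int_affine_le j0 N r) simp
    finally show "(\<integral>\<^sup>+y. indicator ?A (\<chi> i. (f(j0 := y)) i) \<partial>lborel)
      \<le> ennreal ((4 * N + 4) * r) * indicator (\<Pi>\<^sub>E j\<in>J. {-N..N}) f" .
  qed
  also have "\<dots> = ennreal ((4 * N + 4) * r) * emeasure (\<Pi>\<^sub>M i\<in>J. lborel) (\<Pi>\<^sub>E j\<in>J. {-N..N})"
    using J(1) by (intro nn_integral_cmult_indicator sets_PiM_I_finite) auto
  also have "emeasure (\<Pi>\<^sub>M i\<in>J. lborel) (\<Pi>\<^sub>E j\<in>J. {-N..N}) = ennreal ((2 * N) ^ card J)"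
    using J(1) N by (simp add: emeasure_PiM ennreal_power)
  finally show ?thesis
    using N r by (simp add: J(4) ennreal_mult')
qed

lemma dist_int_mult_le_iff:
  "dist_int_mult X a \<le> r \<longleftrightarrow> (\<forall>i. dist_int (\<Sum>j\<in>UNIV. X $ i $ j * of_int (a $ j)) \<le> r)"
  unfolding dist_int_mult_def by (subst Max_le_iff) auto

lemma borel_measurable_dist_int_mult [measurable]:
  "(\<lambda>X :: real^'n^'m. dist_int_mult X a) \<in> borel_measurable borel"
  unfolding borel_measurable_iff_le dist_int_mult_le_iff by measurable

text \<open>The rows are constrained independently and identically, so the set is an
  \<open>'m\<close>-fold power of the row set. This is the source of the exponent in the summability
  hypothesis.\<close>

lemma emeasure_dist_int_mult_le:
  fixes a :: "int^'n" and N r :: real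
  assumes a: "a \<noteq> 0" and N: "0 \<le> N" and r: "0 \<le> r"
  shows "emeasure lborel {X :: real^'n^'m. (\<forall>i j. \<bar>X $ i $ j\<bar> \<le> N) \<and> dist_int_mult X a \<le> r}
    \<le> ennreal (((4 * N + 4) * (2 * N) ^ (CARD('n) - 1)) ^ CARD('m) * r ^ CARD('m))"
proof -
  interpret product_sigma_finite "\<lambda>i::'m. lborel :: (real^'n) measure" by standard
  define A where "A = {x :: real^'n. (\<forall>j. \<bar>x $ j\<bar> \<le> N) \<and> dist_int (\<Sum>j\<in>UNIV. x $ j * of_int (a $ j)) \<le> r}"
  have [measurable]: "A \<in> sets borel" unfolding A_def by measurable
  have eq: "{X :: real^'n^'m. (\<forall>i j. \<bar>X $ i $ j\<bar> \<le> N) \<and> dist_int_mult X a \<le> r} = {X. \<forall>i. X $ i \<in> A}"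
    unfolding dist_int_mult_le_iff A_def by auto
  have pre: "(\<lambda>f. \<chi> i. f i) -` {X :: real^'n^'m. \<forall>i. X $ i \<in> A} \<inter> space (\<Pi>\<^sub>M i\<in>(UNIV :: 'm set). (lborel :: (real^'n) measure))
      = (\<Pi>\<^sub>E i\<in>UNIV. A)"
    by (auto simp: space_PiM PiE_iff)
  have "emeasure lborel {X :: real^'n^'m. \<forall>i. X $ i \<in> A} = emeasure lborel A ^ CARD('m)"
    by (subst lborel_vec_eq_distr_PiM, subst emeasure_distr, simp, simp, subst pre) (simp add: emeasure_PiM)
  also have "\<dots> \<le> ennreal ((4 * N + 4) * r * (2 * N) ^ (CARD('n) - 1)) ^ CARD('m)"
    unfolding A_def by (intro power_mono emeasure_dist_int_row_le a N r) simp
  also have "\<dots> = ennreal (((4 * N + 4) * (2 * N) ^ (CARD('n) - 1)) ^ CARD('m) * r ^ CARD('m))"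
    using N r by (simp add: ennreal_power power_mult_distrib mult_ac)
  finally show ?thesis unfolding eq .
qed

section \<open>Summation over all non-zero integer vectors\<close>

lemma badly_approx_sets_borel [measurable]: "badly_approx \<Psi> \<kappa> \<in> sets borel"
  unfolding badly_approx_def by measurable

lemma badly_approx_antimono:
  assumes "\<And>a. 0 \<le> \<Psi> a" and "\<kappa> \<le> \<kappa>'"
  shows "badly_approx \<Psi> \<kappa>' \<subseteq> badly_approx \<Psi> \<kappa>"
  unfolding badly_approx_def using le_less_trans[OF mult_right_mono[OF assms(2,1)]] by blast

lemma emeasure_not_badly_approx_le:
  fixes \<Psi> :: "int^'n \<Rightarrow> real" and N \<kappa> :: real
  assumes \<Psi>: "\<And>a. 0 \<le> \<Psi> a" and sum: "(\<lambda>a. \<Psi> a ^ CARD('m)) summable_on (UNIV - {0})"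
    and N: "0 \<le> N" and \<kappa>: "0 \<le> \<kappa>"
  shows "emeasure lborel {X :: real^'n^'m. (\<forall>i j. \<bar>X $ i $ j\<bar> \<le> N) \<and> X \<notin> badly_approx \<Psi> \<kappa>}
    \<le> ennreal (((4 * N + 4) * (2 * N) ^ (CARD('n) - 1)) ^ CARD('m) * \<kappa> ^ CARD('m)
        * (\<Sum>\<^sub>\<infinity>a\<in>UNIV - {0}. \<Psi> a ^ CARD('m)))"
proof -
  define C where "C = ((4 * N + 4) * (2 * N) ^ (CARD('n) - 1)) ^ CARD('m) * \<kappa> ^ CARD('m)"
  have C: "0 \<le> C" using N \<kappa> by (simp add: C_def)
  \<comment> \<open>Countable subadditivity is applied to a sequence, whereas the hypothesis is an
    unordered sum; an enumeration of the non-zero vectors links the two.\<close>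
  define e where "e = from_nat_into (UNIV - {0 :: int^'n})"
  have bij: "bij_betw e UNIV (UNIV - {0})"
    unfolding e_def by (intro bij_betw_from_nat_into) (auto simp: infinite_UNIV_vec infinite_UNIV_int)
  have e: "e k \<noteq> 0" for k using bij by (auto simp: bij_betw_def)
  have so: "(\<lambda>k. \<Psi> (e k) ^ CARD('m)) summable_on UNIV"
    using summable_on_reindex_bij_betw[OF bij, of "\<lambda>a. \<Psi> a ^ CARD('m)"] sum by simp
  have inf: "(\<Sum>k. \<Psi> (e k) ^ CARD('m)) = (\<Sum>\<^sub>\<infinity>a\<in>UNIV - {0}. \<Psi> a ^ CARD('m))"
    using infsum_reindex_bij_betw[OF bij, of "\<lambda>a. \<Psi> a ^ CARD('m)"]
      has_sum_imp_sums[OF has_sum_infsum[OF so]] by (simp add: sums_iff)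
  define S where "S k = {X :: real^'n^'m. (\<forall>i j. \<bar>X $ i $ j\<bar> \<le> N) \<and> dist_int_mult X (e k) \<le> \<kappa> * \<Psi> (e k)}" for k
  have [measurable]: "S k \<in> sets borel" for k unfolding S_def by measurable
  have "\<exists>k. a = e k" if "a \<noteq> 0" for a
    using that bij by (auto simp: bij_betw_def image_iff set_eq_iff)
  then have eq: "{X :: real^'n^'m. (\<forall>i j. \<bar>X $ i $ j\<bar> \<le> N) \<and> X \<notin> badly_approx \<Psi> \<kappa>} = (\<Union>k. S k)"
    using e unfolding badly_approx_def S_def by (auto simp: not_less) blast
  have "emeasure lborel (\<Union>k. S k) \<le> (\<Sum>k. emeasure lborel (S k))"
    by (intro emeasure_subadditive_countably) auto
  also have "\<dots> \<le> (\<Sum>k. ennreal (C * \<Psi> (e k) ^ CARD('m)))"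
  proof (intro suminf_le summableI)
    fix k
    show "emeasure lborel (S k) \<le> ennreal (C * \<Psi> (e k) ^ CARD('m))"
      using emeasure_dist_int_mult_le[OF e N mult_nonneg_nonneg[OF \<kappa> \<Psi>], of k "e k", where 'm = 'm]
      by (simp add: S_def C_def power_mult_distrib mult_ac)
  qed
  also have "\<dots> = ennreal (\<Sum>k. C * \<Psi> (e k) ^ CARD('m))"
    using C \<Psi> so by (intro suminf_ennreal2 summable_mult summable_on_imp_summable) auto
  also have "(\<Sum>k. C * \<Psi> (e k) ^ CARD('m)) = C * (\<Sum>k. \<Psi> (e k) ^ CARD('m))"
    by (intro suminf_mult summable_on_imp_summable so)
  finally show ?thesis unfolding eq inf C_def .
qed

text \<open>The estimate has a constant growing with the cube, so \<kappa> tends to 0 with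
  \<open>N\<close> fixed; only then do the cubes exhaust the space, as a countable union of null
  sets.\<close>

lemma null_sets_never_badly_approx:
  fixes \<Psi> :: "int^'n \<Rightarrow> real"
  assumes \<Psi>: "\<And>a. 0 \<le> \<Psi> a" and sum: "(\<lambda>a. \<Psi> a ^ CARD('m)) summable_on (UNIV - {0})"
  shows "(\<Inter>k::nat. - badly_approx \<Psi> (1 / real (Suc k))) \<in> null_sets (lborel :: (real^'n^'m) measure)"
    (is "?Z \<in> _")
proof -
  define Q where "Q N = ?Z \<inter> {X :: real^'n^'m. \<forall>i j. \<bar>X $ i $ j\<bar> \<le> N}" for N :: real
  have [measurable]: "Q N \<in> sets borel" for N unfolding Q_def by measurable
  have "Q (real N) \<in> null_sets lborel" for N
  proof -
    define C where "C = ((4 * real N + 4) * (2 * real N) ^ (CARD('n) - 1)) ^ CARD('m)"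
    define s where "s = (\<Sum>\<^sub>\<infinity>a\<in>UNIV - {0}. \<Psi> a ^ CARD('m))"
    have le: "emeasure lborel (Q N) \<le> ennreal (C * (1 / real (Suc k)) ^ CARD('m) * s)" for k
    proof -
      have "emeasure lborel (Q N) \<le> emeasure lborel
          {X :: real^'n^'m. (\<forall>i j. \<bar>X $ i $ j\<bar> \<le> N) \<and> X \<notin> badly_approx \<Psi> (1 / real (Suc k))}"
        by (intro emeasure_mono) (auto simp: Q_def)
      also have "\<dots> \<le> ennreal (C * (1 / real (Suc k)) ^ CARD('m) * s)"
        unfolding C_def s_def by (intro emeasure_not_badly_approx_le \<Psi> sum) auto
      finally show ?thesis .
    qed
    have "(\<lambda>k. ennreal (C * (1 / real (Suc k)) ^ CARD('m) * s)) \<longlonglongrightarrow> ennreal (C * 0 ^ CARD('m) * s)"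
      by (intro tendsto_ennrealI tendsto_intros) (rule LIMSEQ_Suc[OF lim_1_over_n])
    then have "emeasure lborel (Q N) \<le> ennreal (C * 0 ^ CARD('m) * s)"
      by (rule LIMSEQ_le_const) (use le in blast)
    \<comment> \<open>The limit vanishes because the exponent \<open>CARD('m)\<close> is
      positive.\<close>
    then show ?thesis by (auto intro!: null_setsI simp: zero_power)
  qed
  then have "(\<Union>N. Q (real N)) \<in> null_sets lborel" by auto
  moreover have "?Z = (\<Union>N. Q (real N))"
  proof -
    have "\<exists>N. \<forall>i j. \<bar>X $ i $ j\<bar> \<le> real N" for X :: "real^'n^'m"
    proof -
      obtain N where "norm X \<le> real N" using real_arch_simple by blast
      then have "\<bar>X $ i $ j\<bar> \<le> real N" for i j
        using component_le_norm_cart[of "X $ i" j] Finite_Cartesian_Product.norm_nth_le[of X i] by linarith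
      then show ?thesis by blast
    qed
    then have "(\<Union>N. {X :: real^'n^'m. \<forall>i j. \<bar>X $ i $ j\<bar> \<le> real N}) = UNIV" by auto
    then show ?thesis unfolding Q_def Int_UN_distrib[symmetric] by simp
  qed
  ultimately show ?thesis by simp
qed

text \<open>Absolute continuity enters only through null sets. Hence \<kappa> tends to 0 twice:
  first for Lebesgue measure, to obtain a null set, then for \<mu>, whose finiteness gives
  continuity from above.\<close>

theorem theorem1:
  fixes \<mu> :: "(real^'n^'m) measure"
    and \<Psi> :: "int^'n \<Rightarrow> real"
    and \<delta> :: real
  assumes "prob_space \<mu>"
    and "sets \<mu> = sets borel"
    and "absolutely_continuous lborel \<mu>"
    and "\<And>a. 0 \<le> \<Psi> a"
    and "(\<lambda>a. \<Psi> a ^ CARD('m)) summable_on (UNIV - {0})"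
    and "0 < \<delta>" and "\<delta> < 1"
  shows "\<exists>\<kappa>>0. measure \<mu> (badly_approx \<Psi> \<kappa>) \<ge> 1 - \<delta>"
proof -
  interpret prob_space \<mu> by fact
  note [measurable_cong] = assms(2)
  have space: "space \<mu> = UNIV" using sets_eq_imp_space_eq[OF assms(2)] by simp
  \<comment> \<open>The values \<open>1 / real (Suc k)\<close> are positive and decrease to 0, so
    these exceptional sets shrink, and any one of small measure supplies the witness for
    \<kappa>.\<close>
  define D :: "nat \<Rightarrow> (real^'n^'m) set" where "D k = - badly_approx \<Psi> (1 / real (Suc k))" for k
  have D: "range D \<subseteq> sets \<mu>" by (auto simp: D_def assms(2))
  have "decseq D" unfolding D_def
    by (intro antimonoI Compl_anti_mono badly_approx_antimono assms(4) frac_le) auto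
  with D have "(\<lambda>k. measure \<mu> (D k)) \<longlonglongrightarrow> measure \<mu> (\<Inter>k. D k)"
    by (rule finite_Lim_measure_decseq)
  moreover have "(\<Inter>k. D k) \<in> null_sets \<mu>"
    using null_sets_never_badly_approx[OF assms(4,5)] assms(3)
    by (auto simp: absolutely_continuous_def D_def)
  ultimately have "(\<lambda>k. measure \<mu> (D k)) \<longlonglongrightarrow> 0"
    by (simp add: null_sets_def measure_def)
  then have "eventually (\<lambda>k. measure \<mu> (D k) < \<delta>) sequentially"
    using assms(6) by (rule order_tendstoD)
  then obtain k where "measure \<mu> (D k) < \<delta>" by (auto simp: eventually_sequentially)
  moreover have "measure \<mu> (D k) = 1 - measure \<mu> (badly_approx \<Psi> (1 / real (Suc k)))"
    unfolding D_def Compl_eq_Diff_UNIV space[symmetric] by (intro prob_compl) (simp add: assms(2))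
  ultimately show ?thesis by (intro exI[of _ "1 / real (Suc k)"]) auto
qed

end
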